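(* Let $h, p \ge 1$ and let $n, d, d_h, d_{f1},\dots,d_{fp}, d_{h1},\dots,d_{hp}$ be positive integers with $d_h = d/h$, $d_{hj} = d_{fj}/h$ and $d_{fj}\le d$ for all $j\in\{1,\dots,p\}$. Suppose that $d_{hj}\le d_h$ for all $j$, and that both $d \ge d_h + \sum_{j=1}^p d_{hj}$ and $n \ge d_h + \sum_{j=1}^p d_{hj}$. (1) For any $R\in\mathbb{R}^{n\times d}$ and any $W_Q, W_K\in\mathbb{R}^{d\times d_h}$, the matrix $\mathrm{att} = R\, W_Q W_K^\top R^\top\in\mathbb{R}^{n\times n}$ satisfies $$\operatorname{rank}(\mathrm{att}) \le d_h .$$ (2) There exists a choice of matrices $R^{(ID)}\in\mathbb{R}^{n\times d}$, $W_Q, W_K\in\mathbb{R}^{d\times d_h}$, and, for each $j\in\{1,\dots,p\}$, $E^{fj}\in\mathbb{R}^{n\times d_{fj}}$ and $W_Q^{fj}, W_K^{fj}\in\mathbb{R}^{d_{fj}\times d_{hj}}$, such that the matrix $$\mathrm{DIF\_att} = R^{(ID)} W_Q W_K^\top R^{(ID)\top} + \sum_{j=1}^{p} E^{fj} W_Q^{fj} W_K^{fj\top} E^{fj\top}\in\mathbb{R}^{n\times n}$$ satisfies $$\operatorname{rank}(\mathrm{DIF\_att}) = d_h + \sum_{j=1}^p d_{hj} > d_h .$$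
   Context: All matrices are real, and $\top$ denotes transpose. The superscripts $(ID)$ and $fj$ are only labels (item representation, and $j$-th attribute), not powers; thus $E^{fj\top}$ means $(E^{fj})^\top$, and likewise for $R^{(ID)\top}$ and $W_K^{fj\top}$. Interpretation (not needed for the proof): $n$ is the sequence length, $d$ the item embedding size, $h$ the number of attention heads, $d_h$ the per-head query/key projection size for items, $p$ the number of attribute types, $d_{fj}$ the embedding size of attribute $j$, and $d_{hj}$ its per-head projection size. The matrix $\mathrm{att}$ is the (pre-softmax) attention matrix of one head for an integrated representation $R$, and $\mathrm{DIF\_att}$ is the attention matrix of one head when item and attribute attention matrices are computed separately and fused by addition. *)

theory Defs
  imports "Jordan_Normal_Form.DL_Rank"
begin

definition att :: "real mat \<Rightarrow> real mat \<Rightarrow> real mat \<Rightarrow> real mat" where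
  "att R W\<^sub>Q W\<^sub>K = R * W\<^sub>Q * transpose_mat W\<^sub>K * transpose_mat R"

text \<open>
  Matrices of all sizes share one type, so \<open>\<Sum>\<close> is not available on them; the sum over the
  attributes \<open>j = 1, \<dots>, p\<close> is the sum in the module of \<open>n \<times> n\<close> matrices.
  \<open>V\<^sub>Q j\<close> and \<open>V\<^sub>K j\<close> are the query and key projections of attribute \<open>j\<close>.
\<close>

definition DIF_att ::
  "nat \<Rightarrow> nat \<Rightarrow> real mat \<Rightarrow> real mat \<Rightarrow> real mat
    \<Rightarrow> (nat \<Rightarrow> real mat) \<Rightarrow> (nat \<Rightarrow> real mat) \<Rightarrow> (nat \<Rightarrow> real mat) \<Rightarrow> real mat" where
  "DIF_att n p R W\<^sub>Q W\<^sub>K E V\<^sub>Q V\<^sub>K =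
     R * W\<^sub>Q * transpose_mat W\<^sub>K * transpose_mat R
     + (\<Oplus>\<^bsub>module_mat TYPE(real) n n\<^esub> j \<in> {1..p}.
          E j * V\<^sub>Q j * transpose_mat (V\<^sub>K j) * transpose_mat (E j))"

end

theory Submission
  imports Defs
begin

text \<open>
  The attention matrix of one head factors through a space of dimension \<open>d\<^sub>h\<close>, which bounds its
  rank. For the fused matrix, let item and attributes select pairwise disjoint consecutive blocks of
  coordinates: each summand becomes the projection onto its block, and the sum is the projection
  onto the first \<open>d\<^sub>h + (\<Sum>j = 1..p. dh j)\<close> coordinates.
\<close>

text \<open>Each column of \<open>A * B\<close> is \<open>A\<close> applied to a column of
  \<open>B\<close>, so the column space of the product lies inside that of \<open>A\<close>, and
  dimension is monotone on nested subspaces.\<close>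

lemma (in vec_space) rank_mult_le:
  assumes A: "A \<in> carrier_mat n m" and B: "B \<in> carrier_mat m l"
  shows "rank (A * B) \<le> rank A"
proof -
  have AB: "A * B \<in> carrier_mat n l" using A B by simp
  have "set (cols (A * B)) \<subseteq> span (set (cols A))"
  proof
    fix x assume "x \<in> set (cols (A * B))"
    then obtain i where i: "i < l" and x: "x = col (A * B) i"
      using A B by (auto simp: cols_def)
    have "x = A *\<^sub>v col B i" using x i A B by (metis col_mult2)
    moreover have "col B i \<in> carrier_vec m" using B i by auto
    ultimately have "x \<in> col_space A"
      using A unfolding col_space_eq[OF A] by auto
    then show "x \<in> span (set (cols A))" unfolding col_space_def .
  qed
  moreover have subA: "subspace class_ring (span (set (cols A))) V"
    using A by (metis carrier_matD(1) cols_dim span_is_subspace)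
  moreover have subAB: "subspace class_ring (span (set (cols (A * B)))) V"
    using AB by (metis carrier_matD(1) cols_dim span_is_subspace)
  ultimately have "span (set (cols (A * B))) \<subseteq> span (set (cols A))"
    by (simp add: span_is_subset subspace_def)
  from nested_subspaces[OF subA subAB this] show ?thesis
    unfolding rank_def
    using vectorspace.subspace_dim[OF subspace_is_vs[OF subA]]
      fin_dim_span_cols[OF A] fin_dim_span_cols[OF AB] by auto
qed

text \<open>Brings an attention product into the form \<open>X * transpose_mat Y\<close> with
  \<open>X\<close> and \<open>Y\<close> of only \<open>m\<close> columns; both the rank bound and
  the block computation start from this form.\<close>

lemma mat_mult_transpose_assoc:
  fixes R :: "'a :: comm_semiring_1 mat"
  assumes "R \<in> carrier_mat n d" "P \<in> carrier_mat d m" "Q \<in> carrier_mat d m"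
  shows "R * P * transpose_mat Q * transpose_mat R = (R * P) * transpose_mat (R * Q)"
proof -
  have "(R * P) * transpose_mat (R * Q) = (R * P) * (transpose_mat Q * transpose_mat R)"
    using assms by (simp add: transpose_mult)
  also have "\<dots> = R * P * transpose_mat Q * transpose_mat R"
    using assms by (intro assoc_mult_mat[symmetric, where ?n\<^sub>1 = n and ?n\<^sub>2 = m and ?n\<^sub>3 = d and ?n\<^sub>4 = n]) auto
  finally show ?thesis by simp
qed

text \<open>The left factor \<open>R * P\<close> has \<open>m\<close> columns, and multiplying on
  the right cannot raise the rank.\<close>

lemma rank_att_le:
  assumes "R \<in> carrier_mat n d" "P \<in> carrier_mat d m" "Q \<in> carrier_mat d m"
  shows "vec_space.rank n (att R P Q) \<le> m"
proof -
  have "vec_space.rank n ((R * P) * transpose_mat (R * Q)) \<le> vec_space.rank n (R * P)"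
    using assms by (intro vec_space.rank_mult_le[where m = m and l = n]) auto
  also have "\<dots> \<le> m" using assms by (intro vec_space.rank_le_nc) auto
  finally show ?thesis
    unfolding att_def mat_mult_transpose_assoc[OF assms] .
qed

text \<open>As a linear map this sends the \<open>k\<close>-th unit vector to the
  \<open>(s + k)\<close>-th, or to zero once \<open>s + k\<close> reaches \<open>n\<close>. With
  \<open>s = 0\<close> it also serves as a weight matrix that selects leading coordinates.\<close>

definition shift_mat :: "nat \<Rightarrow> nat \<Rightarrow> nat \<Rightarrow> 'a :: zero_neq_one mat" where
  "shift_mat n m s = mat n m (\<lambda>(i, k). if i = s + k then 1 else 0)"

lemma shift_mat_carrier [simp]: "shift_mat n m s \<in> carrier_mat n m"
  by (simp add: shift_mat_def)

definition block_proj :: "nat \<Rightarrow> nat \<Rightarrow> nat \<Rightarrow> 'a :: zero_neq_one mat" where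
  "block_proj n s m = mat n n (\<lambda>(i, k). if i = k \<and> s \<le> i \<and> i < s + m then 1 else 0)"

lemma block_proj_carrier [simp]: "block_proj n s m \<in> carrier_mat n n"
  by (simp add: block_proj_def)

lemma shift_mat_mult:
  assumes "r \<le> m"
  shows "shift_mat n m s * shift_mat m r 0 = (shift_mat n r s :: 'a :: semiring_1 mat)"
proof (rule eq_matI)
  fix i k assume "i < dim_row (shift_mat n r s :: 'a mat)" "k < dim_col (shift_mat n r s :: 'a mat)"
  then have i: "i < n" and k: "k < r" by (auto simp: shift_mat_def)
  have "(shift_mat n m s * shift_mat m r 0 :: 'a mat) $$ (i, k)
      = (\<Sum>t = 0..<m. (if i = s + t then 1 else 0) * (if t = k then 1 else 0))"
    using i k assms by (simp add: shift_mat_def scalar_prod_def)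
  also have "\<dots> = (\<Sum>t = 0..<m. if t = k then (if i = s + t then 1 else 0) else 0)"
    by (intro sum.cong) auto
  also have "\<dots> = (if i = s + k then 1 else 0)" using k assms by simp
  finally show "(shift_mat n m s * shift_mat m r 0 :: 'a mat) $$ (i, k) = shift_mat n r s $$ (i, k)"
    using i k by (simp add: shift_mat_def)
qed (auto simp: shift_mat_def)

lemma shift_mat_mult_transpose:
  "shift_mat n m s * transpose_mat (shift_mat n m s) = (block_proj n s m :: 'a :: semiring_1 mat)"
proof (rule eq_matI)
  fix i k assume "i < dim_row (block_proj n s m :: 'a mat)" "k < dim_col (block_proj n s m :: 'a mat)"
  then have i: "i < n" and k: "k < n" by (auto simp: block_proj_def)
  have "(shift_mat n m s * transpose_mat (shift_mat n m s) :: 'a mat) $$ (i, k)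
      = (\<Sum>t = 0..<m. (if i = s + t then 1 else 0) * (if k = s + t then 1 else 0))"
    using i k by (simp add: shift_mat_def scalar_prod_def)
  \<comment> \<open>Both conditions together force \<open>i = k\<close> and
    \<open>t = i - s\<close>. The guard \<open>s \<le> i\<close> excludes truncated subtraction,
    which would otherwise let \<open>t = 0\<close> count for \<open>i < s\<close>.\<close>
  also have "\<dots> = (\<Sum>t = 0..<m. if t = i - s then (if i = k \<and> s \<le> i then 1 else 0) else 0)"
    by (intro sum.cong) auto
  also have "\<dots> = (if i = k \<and> s \<le> i \<and> i < s + m then 1 else 0)" by auto
  finally show "(shift_mat n m s * transpose_mat (shift_mat n m s) :: 'a mat) $$ (i, k)
      = block_proj n s m $$ (i, k)"
    using i k by (simp add: block_proj_def)
qed (auto simp: shift_mat_def block_proj_def)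

text \<open>Equal query and key weights make the product \<open>X * transpose_mat X\<close>, where
  \<open>X\<close> is the shift matrix cut down to its first \<open>m\<close> columns.\<close>

lemma att_shift_mat:
  assumes "m \<le> d"
  shows "shift_mat n d s * shift_mat d m 0 * transpose_mat (shift_mat d m 0)
      * transpose_mat (shift_mat n d s) = (block_proj n s m :: 'a :: comm_semiring_1 mat)"
  unfolding mat_mult_transpose_assoc[OF shift_mat_carrier shift_mat_carrier shift_mat_carrier]
  by (simp only: shift_mat_mult[OF assms] shift_mat_mult_transpose)

lemma block_proj_add:
  "block_proj n 0 s + block_proj n s m = (block_proj n 0 (s + m) :: 'a :: semiring_1 mat)"
  by (rule eq_matI) (auto simp: block_proj_def)

text \<open>Block \<open>j\<close> starts where block \<open>j - 1\<close> ends, so the sum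
  telescopes by gluing adjacent blocks. The initial block stays outside the sum as the accumulator
  of the induction.\<close>

lemma block_proj_add_finsum:
  fixes m :: "nat \<Rightarrow> nat"
  shows "block_proj n 0 s + (\<Oplus>\<^bsub>module_mat TYPE('a :: comm_ring_1) n n\<^esub> j \<in> {1..p}.
      block_proj n (s + (\<Sum>i = 1..<j. m i)) (m j)) = block_proj n 0 (s + (\<Sum>j = 1..p. m j))"
proof (induction p)
  case 0
  interpret abelian_group "module_mat TYPE('a) n n" by (rule abelian_group_mat)
  show ?case
    using right_add_zero_mat[of "block_proj n 0 s :: 'a mat" n n] by (simp add: module_mat_simps)
next
  case (Suc p)
  interpret abelian_group "module_mat TYPE('a) n n" by (rule abelian_group_mat)
  let ?B = "\<lambda>j. block_proj n (s + (\<Sum>i = 1..<j. m i)) (m j) :: 'a mat"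
  let ?S = "\<Oplus>\<^bsub>module_mat TYPE('a) n n\<^esub> j \<in> {1..p}. ?B j"
  have S: "?S \<in> carrier_mat n n"
    using finsum_closed[of ?B "{1..p}"] by (simp add: module_mat_simps)
  have "(\<Oplus>\<^bsub>module_mat TYPE('a) n n\<^esub> j \<in> {1..Suc p}. ?B j) = ?B (Suc p) + ?S"
    using finsum_insert[of "{1..p}" "Suc p" ?B]
    by (simp add: module_mat_simps atLeastAtMostSuc_conv)
  \<comment> \<open>The new summand is moved to the far right, so that the left side of the
    induction hypothesis appears as a subterm. These laws of matrix addition require
    \<open>S\<close>, the carrier fact.\<close>
  then have "block_proj n 0 s + (\<Oplus>\<^bsub>module_mat TYPE('a) n n\<^esub> j \<in> {1..Suc p}. ?B j)
      = (block_proj n 0 s + ?S) + ?B (Suc p)"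
    using comm_add_mat[OF block_proj_carrier S, of "s + (\<Sum>i = 1..<Suc p. m i)" "m (Suc p)"]
      assoc_add_mat[OF block_proj_carrier S block_proj_carrier,
        of 0 s "s + (\<Sum>i = 1..<Suc p. m i)" "m (Suc p)"]
    by (simp only:)
  also have "\<dots> = block_proj n 0 (s + (\<Sum>j = 1..Suc p. m j))"
    unfolding Suc.IH by (simp add: block_proj_add atLeastLessThanSuc_atLeastAtMost add.assoc)
  finally show ?case .
qed

text \<open>Above, the projection factors through \<open>r\<close> columns; below, the first
  \<open>r\<close> unit vectors are independent columns of it.\<close>

lemma (in vec_space) rank_block_proj:
  assumes "r \<le> n"
  shows "rank (block_proj n 0 r) = r"
proof (rule antisym)
  have "rank (shift_mat n r 0 * transpose_mat (shift_mat n r 0)) \<le> rank (shift_mat n r 0)"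
    by (rule rank_mult_le[where m = r and l = n]) auto
  also have "\<dots> \<le> r" by (rule rank_le_nc) simp
  finally show "rank (block_proj n 0 r) \<le> r" by (simp only: shift_mat_mult_transpose)
next
  let ?U = "unit_vec n ` {..<r} :: 'a vec set"
  have "?U \<subseteq> set (cols (block_proj n 0 r))"
  proof
    fix x assume "x \<in> ?U"
    then obtain i where i: "i < r" "x = unit_vec n i" by auto
    have "col (block_proj n 0 r) i = x"
      using i assms by (intro eq_vecI) (auto simp: block_proj_def)
    then show "x \<in> set (cols (block_proj n 0 r))"
      using i assms by (force simp: cols_def block_proj_def)
  qed
  moreover have "lin_indpt ?U"
    by (rule subset_li_is_li[of "set (unit_vecs n)"])
      (use unit_vecs_basis assms in \<open>auto simp: basis_def unit_vecs_def\<close>)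
  ultimately have "card ?U \<le> rank (block_proj n 0 r)"
    by (intro rank_ge_card_indpt[of _ n]) auto
  \<comment> \<open>Indices below \<open>n\<close> give distinct unit vectors, hence
    \<open>card ?U = r\<close>.\<close>
  moreover have "inj_on (unit_vec n :: nat \<Rightarrow> 'a vec) {..<r}"
    using assms by (auto simp: inj_on_def)
  ultimately show "r \<le> rank (block_proj n 0 r)" by (simp add: card_image)
qed

theorem theorem4p1:
  fixes h p n d d\<^sub>h :: nat
    and df dh :: "nat \<Rightarrow> nat"
  assumes "h \<ge> 1" and "p \<ge> 1"
    and "n > 0" and "d > 0" and "d\<^sub>h > 0"
    and "\<And>j. j \<in> {1..p} \<Longrightarrow> df j > 0"
    and "\<And>j. j \<in> {1..p} \<Longrightarrow> dh j > 0"
    and "real d\<^sub>h = real d / real h"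
    and "\<And>j. j \<in> {1..p} \<Longrightarrow> real (dh j) = real (df j) / real h"
    and "\<And>j. j \<in> {1..p} \<Longrightarrow> df j \<le> d"
    and "\<And>j. j \<in> {1..p} \<Longrightarrow> dh j \<le> d\<^sub>h"
    and "d \<ge> d\<^sub>h + (\<Sum>j = 1..p. dh j)"
    and "n \<ge> d\<^sub>h + (\<Sum>j = 1..p. dh j)"
  shows "(\<forall>R \<in> carrier_mat n d. \<forall>W\<^sub>Q \<in> carrier_mat d d\<^sub>h. \<forall>W\<^sub>K \<in> carrier_mat d d\<^sub>h.
            vec_space.rank n (att R W\<^sub>Q W\<^sub>K) \<le> d\<^sub>h)
       \<and> (\<exists>R \<in> carrier_mat n d. \<exists>W\<^sub>Q \<in> carrier_mat d d\<^sub>h. \<exists>W\<^sub>K \<in> carrier_mat d d\<^sub>h.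
          \<exists>E V\<^sub>Q V\<^sub>K.
            (\<forall>j \<in> {1..p}. E j \<in> carrier_mat n (df j)
                         \<and> V\<^sub>Q j \<in> carrier_mat (df j) (dh j)
                         \<and> V\<^sub>K j \<in> carrier_mat (df j) (dh j))
          \<and> vec_space.rank n (DIF_att n p R W\<^sub>Q W\<^sub>K E V\<^sub>Q V\<^sub>K) = d\<^sub>h + (\<Sum>j = 1..p. dh j)
          \<and> d\<^sub>h + (\<Sum>j = 1..p. dh j) > d\<^sub>h)"
proof (intro conjI ballI)
  show "vec_space.rank n (att R W\<^sub>Q W\<^sub>K) \<le> d\<^sub>h"
    if "R \<in> carrier_mat n d" "W\<^sub>Q \<in> carrier_mat d d\<^sub>h" "W\<^sub>K \<in> carrier_mat d d\<^sub>h" for R W\<^sub>Q W\<^sub>K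
    using that by (rule rank_att_le)
next
  \<comment> \<open>The item occupies the coordinates below \<open>d\<^sub>h\<close>; attribute
    \<open>j\<close> starts after the item and all earlier attributes.\<close>
  let ?s = "\<lambda>j. d\<^sub>h + (\<Sum>i = 1..<j. dh i)"
  let ?R = "shift_mat n d 0 :: real mat" and ?W = "shift_mat d d\<^sub>h 0 :: real mat"
  \<comment> \<open>The ranges of the \<open>?E j\<close> may overlap, since \<open>df j\<close> can
    exceed \<open>dh j\<close>; multiplying by \<open>?V j\<close> keeps only the first
    \<open>dh j\<close> columns and makes the blocks disjoint.\<close>
  let ?E = "\<lambda>j. shift_mat n (df j) (?s j) :: real mat"
  let ?V = "\<lambda>j. shift_mat (df j) (dh j) 0 :: real mat"
  have dh: "dh j \<le> df j" if "j \<in> {1..p}" for j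
  proof -
    have "real (dh j) * real h = real (df j)" using assms(1) assms(9)[OF that] by simp
    then have "df j = dh j * h" by (metis of_nat_eq_iff of_nat_mult)
    then show ?thesis using assms(1) by simp
  qed
  have d: "d\<^sub>h \<le> d" using assms(12) by simp
  interpret abelian_group "module_mat TYPE(real) n n" by (rule abelian_group_mat)
  have "DIF_att n p ?R ?W ?W ?E ?V ?V = block_proj n 0 d\<^sub>h
      + (\<Oplus>\<^bsub>module_mat TYPE(real) n n\<^esub> j \<in> {1..p}. block_proj n (?s j) (dh j))"
    unfolding DIF_att_def att_shift_mat[OF d]
    \<comment> \<open>The summands are rewritten only for \<open>j\<close> in \<open>{1..p}\<close>,
      where \<open>dh\<close> allows \<open>att_shift_mat\<close> to be applied.\<close>
    by (intro arg_cong2[where f = "(+)"] refl finsum_cong')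
      (auto simp: att_shift_mat dh module_mat_simps)
  also have "\<dots> = block_proj n 0 (d\<^sub>h + (\<Sum>j = 1..p. dh j))"
    by (rule block_proj_add_finsum)
  \<comment> \<open>All blocks fit into the \<open>n\<close> coordinates, so none is truncated and
    the rank is the total block length.\<close>
  finally have "vec_space.rank n (DIF_att n p ?R ?W ?W ?E ?V ?V) = d\<^sub>h + (\<Sum>j = 1..p. dh j)"
    using vec_space.rank_block_proj[OF assms(13)] by simp
  \<comment> \<open>Strictness comes from having at least one attribute, each of positive projection
    size.\<close>
  moreover have "(\<Sum>j = 1..p. dh j) > 0"
    using assms(2,7) by (intro sum_pos) auto
  ultimately show "\<exists>R \<in> carrier_mat n d. \<exists>W\<^sub>Q \<in> carrier_mat d d\<^sub>h. \<exists>W\<^sub>K \<in> carrier_mat d d\<^sub>h.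
      \<exists>E V\<^sub>Q V\<^sub>K.
        (\<forall>j \<in> {1..p}. E j \<in> carrier_mat n (df j)
                     \<and> V\<^sub>Q j \<in> carrier_mat (df j) (dh j)
                     \<and> V\<^sub>K j \<in> carrier_mat (df j) (dh j))
      \<and> vec_space.rank n (DIF_att n p R W\<^sub>Q W\<^sub>K E V\<^sub>Q V\<^sub>K) = d\<^sub>h + (\<Sum>j = 1..p. dh j)
      \<and> d\<^sub>h + (\<Sum>j = 1..p. dh j) > d\<^sub>h"
    by (intro bexI[of _ ?R] bexI[of _ ?W] exI[of _ ?E] exI[of _ ?V]) auto
qed

end
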